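(* Let $\alpha,\beta,\gamma,\delta\in\mathbb{Z}$ with $1\le\alpha<\gamma$, let $(\alpha,\gamma)$ denote the greatest common divisor of $\alpha$ and $\gamma$, and write $\alpha=\alpha_1(\alpha,\gamma)$, $\gamma=\gamma_1(\alpha,\gamma)$. Let $d_i$ ($i\in\mathbb{N}\cup\{\infty\}$) be the densities of the sets $A_i$ defined in the context. Then all $d_i$ exist and: (1) If $\alpha=1$, then $d_i=0$ for all $i\in\mathbb{N}$ and $d_\infty=1-\frac1\gamma$. (2) If $(\alpha,\gamma)\nmid(\delta-\beta)$, then $d_1=1-\frac1\alpha-\frac1\gamma$, $d_2=\frac1\alpha$, $d_i=0$ for all $i\ge3$, and $d_\infty=0$. (3) If $\alpha>1$, $(\alpha,\gamma)\mid(\delta-\beta)$ and $\alpha_1=1$, then $$d_1=1-\frac1\alpha-\frac1\gamma+\frac{1}{(\alpha,\gamma)\alpha_1\gamma_1},\qquad d_i=0\ \text{ for all } i\ge2,\qquad d_\infty=\frac{\gamma_1-1}{\alpha\gamma_1}.$$ (4) If $\alpha>1$, $(\alpha,\gamma)\mid(\delta-\beta)$ and $\alpha_1>1$, then $$d_1=1-\frac1\alpha-\frac1\gamma+\frac{1}{(\alpha,\gamma)\alpha_1\gamma_1},\qquad d_i=\frac{(\gamma_1-1)(\alpha_1-1)}{\gamma_1\alpha\alpha_1^{i-1}}\ \text{ for all } i\ge2,\qquad d_\infty=0.$$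
   Context: Notation: $\mathbb{N}=\{1,2,3,\dots\}$ and $\lfloor\cdot\rfloor$ is the floor function (which acts trivially here since all parameters are integers). Define $S(\alpha,\beta)=\{\lfloor\alpha k+\beta\rfloor:k\in\mathbb{N}\}\cap\mathbb{N}$, and similarly $S(\gamma,\delta)$. Define the map $f:\{\lfloor\alpha k+\beta\rfloor:k\in\mathbb{N}\}\to\{\lfloor\gamma k+\delta\rfloor:k\in\mathbb{N}\}$ by $f(\lfloor\alpha k+\beta\rfloor)=\lfloor\gamma k+\delta\rfloor$. Define - $A_1=\mathbb{N}\setminus[S(\alpha,\beta)\cup S(\gamma,\delta)]$; - $A_2=\{x\in S(\alpha,\beta)\setminus S(\gamma,\delta): f(x)\in S(\gamma,\delta)\setminus S(\alpha,\beta)\}$; - for $i\ge3$, $A_i=\{x\in S(\alpha,\beta)\setminus S(\gamma,\delta): f^j(x)\in S(\alpha,\beta)\cap S(\gamma,\delta)\text{ for all }1\le j\le i-2,\ f^{i-1}(x)\in S(\gamma,\delta)\setminus S(\alpha,\beta)\}$; - $A_\infty=\{x\in S(\alpha,\beta)\setminus S(\gamma,\delta): f^j(x)\in S(\alpha,\beta)\cap S(\gamma,\delta)\text{ for all }j\ge1\}$. For $i\in\mathbb{N}\cup\{\infty\}$ the density of $A_i$ is $$d_i=\lim_{|n_1-n_2|\to\infty}\frac{|A_i\cap[n_1,n_2]|}{|n_1-n_2|}\qquad(n_1<n_2\text{ in }\mathbb{N}),$$ a limit as $|n_1-n_2|\to\infty$ irrespective of the position of the interval. *)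

theory Defs
  imports Complex_Main
begin

text \<open>The positive integers are represented as a subset of \<^typ>\<open>int\<close>, since the terms
  of the sequences below may be zero or negative.\<close>

definition beatty_range :: "real \<Rightarrow> real \<Rightarrow> int set" where
  "beatty_range \<alpha> \<beta> = {\<lfloor>\<alpha> * real k + \<beta>\<rfloor> | k :: nat. k \<ge> 1}"

definition beatty_set :: "real \<Rightarrow> real \<Rightarrow> int set" where
  "beatty_set \<alpha> \<beta> = beatty_range \<alpha> \<beta> \<inter> {1..}"

text \<open>The map from \<open>beatty_range \<alpha> \<beta>\<close> to \<open>beatty_range \<gamma> \<delta>\<close>. It is well defined for
  \<open>\<alpha> \<ge> 1\<close>, because then distinct \<open>k\<close> give distinct \<open>\<lfloor>\<alpha> k + \<beta>\<rfloor>\<close>. Its values outside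
  \<open>beatty_range \<alpha> \<beta>\<close> are unspecified; the sets below never depend on them, because an
  iterate is only inspected when all earlier ones are required to lie in \<open>beatty_set \<alpha> \<beta>\<close>.\<close>

definition beatty_map :: "real \<Rightarrow> real \<Rightarrow> real \<Rightarrow> real \<Rightarrow> int \<Rightarrow> int" where
  "beatty_map \<alpha> \<beta> \<gamma> \<delta> x =
     (THE y. \<exists>k::nat. k \<ge> 1 \<and> x = \<lfloor>\<alpha> * real k + \<beta>\<rfloor> \<and> y = \<lfloor>\<gamma> * real k + \<delta>\<rfloor>)"

text \<open>Only indices \<open>i \<ge> 1\<close> are meaningful; the value at \<open>0\<close> is a dummy.\<close>

definition chain_set :: "real \<Rightarrow> real \<Rightarrow> real \<Rightarrow> real \<Rightarrow> nat \<Rightarrow> int set" where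
  "chain_set \<alpha> \<beta> \<gamma> \<delta> i =
    (if i = 0 then {}
     else if i = 1 then {1..} - (beatty_set \<alpha> \<beta> \<union> beatty_set \<gamma> \<delta>)
     else if i = 2 then {x \<in> beatty_set \<alpha> \<beta> - beatty_set \<gamma> \<delta>. beatty_map \<alpha> \<beta> \<gamma> \<delta> x \<in> beatty_set \<gamma> \<delta> - beatty_set \<alpha> \<beta>}
     else {x \<in> beatty_set \<alpha> \<beta> - beatty_set \<gamma> \<delta>.
             (\<forall>j. 1 \<le> j \<and> j \<le> i - 2 \<longrightarrow> (beatty_map \<alpha> \<beta> \<gamma> \<delta> ^^ j) x \<in> beatty_set \<alpha> \<beta> \<inter> beatty_set \<gamma> \<delta>) \<and>
             (beatty_map \<alpha> \<beta> \<gamma> \<delta> ^^ (i - 1)) x \<in> beatty_set \<gamma> \<delta> - beatty_set \<alpha> \<beta>})"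

definition chain_set_inf :: "real \<Rightarrow> real \<Rightarrow> real \<Rightarrow> real \<Rightarrow> int set" where
  "chain_set_inf \<alpha> \<beta> \<gamma> \<delta> =
    {x \<in> beatty_set \<alpha> \<beta> - beatty_set \<gamma> \<delta>. \<forall>j\<ge>1. (beatty_map \<alpha> \<beta> \<gamma> \<delta> ^^ j) x \<in> beatty_set \<alpha> \<beta> \<inter> beatty_set \<gamma> \<delta>}"

text \<open>The filter on pairs of positive integers \<open>n1 < n2\<close> for \<open>\<bar>n1 - n2\<bar> \<rightarrow> \<infinity>\<close>. Convergence
  along it is uniform in the position of the interval.\<close>

definition long_intervals :: "(int \<times> int) filter" where
  "long_intervals =
     inf (filtercomap (\<lambda>(n1, n2). \<bar>n1 - n2\<bar>) at_top)
         (principal {(n1, n2). 1 \<le> n1 \<and> n1 < n2})"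

definition has_density :: "int set \<Rightarrow> real \<Rightarrow> bool" where
  "has_density X d \<longleftrightarrow>
     ((\<lambda>(n1, n2). real (card (X \<inter> {n1..n2})) / real_of_int \<bar>n1 - n2\<bar>) \<longlongrightarrow> d) long_intervals"

text \<open>Limits along this filter are unique, so the density is determined whenever it exists.\<close>

lemma long_intervals_neq_bot: "long_intervals \<noteq> bot"
proof
  assume "long_intervals = bot"
  then have "eventually (\<lambda>_. False) long_intervals" by simp
  then obtain N :: int where
    N: "\<And>n1 n2. N \<le> \<bar>n1 - n2\<bar> \<Longrightarrow> 1 \<le> n1 \<Longrightarrow> n1 < n2 \<Longrightarrow> False"
    unfolding long_intervals_def eventually_inf_principal eventually_filtercomap
      eventually_at_top_linorder by fastforce
  show False by (rule N[of 1 "\<bar>N\<bar> + 2"]) auto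
qed

lemma has_density_unique: "has_density X d \<Longrightarrow> has_density X d' \<Longrightarrow> d = d'"
  unfolding has_density_def by (rule tendsto_unique[OF long_intervals_neq_bot])

definition interval_density :: "int set \<Rightarrow> real" where
  "interval_density X = (THE d. has_density X d)"

lemma interval_density_eq: "has_density X d \<Longrightarrow> interval_density X = d"
  unfolding interval_density_def by (blast intro: has_density_unique)

end

theory Submission
  imports Defs "HOL-Number_Theory.Cong"
begin

text \<open>Write the first sequence as \<open>\<alpha> k + \<beta>\<close> and work with the index \<open>k\<close>. Beyond a finite threshold
  the conditions \<open>k \<ge> 1\<close> and positivity hold automatically and \<open>f\<close> does not decrease, so that
  no orbit ever falls below the threshold again. There membership in either
  sequence is a congruence condition, and finitely many integers do not affect a density.

  Put \<open>g = gcd \<alpha> \<gamma>\<close>. If \<open>g\<close> does not divide \<open>\<delta> - \<beta>\<close>, the two progressions are disjoint and every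
  orbit leaves the first one after one step. Otherwise let \<open>\<delta> - \<beta> = e g\<close>. One step of \<open>f\<close> turns
  the index \<open>k\<close> into \<open>(\<gamma>1 k + e) / \<alpha>1\<close>, which has to be an integer for the orbit to stay in the first
  progression. Since \<open>\<gamma>1\<close> is invertible modulo powers of \<open>\<alpha>1\<close>, the indices that survive \<open>n\<close> steps
  form a single residue class modulo \<open>\<alpha>1 ^ n\<close> (\<open>survivors_residue_class\<close>). The indices of
  elements common to both progressions form a residue class modulo \<open>\<gamma>1\<close>, which is independent of
  the former by the Chinese remainder theorem. Hence the terms that survive \<open>n\<close> steps and
  are not in the second progression have density \<open>s n = (1 - 1/\<gamma>1) / (\<alpha> \<alpha>1 ^ n)\<close>
  (\<open>has_density_survivors\<close>). Among them, those that do not survive a further step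
  make up \<open>A\<^sub>i\<close> with \<open>i = n + 2\<close>, up to a finite set; so the density of \<open>A\<^sub>i\<close> is \<open>s n - s (n + 1)\<close>.
  The density of \<open>A\<^sub>1\<close> follows by inclusion and exclusion. Finally, \<open>A\<^sub>\<infinity>\<close> is, up to a
  finite set, contained in all these sets of survivors: if \<open>\<alpha>1 > 1\<close> then \<open>s n\<close> tends to \<open>0\<close> and the
  density of \<open>A\<^sub>\<infinity>\<close> is squeezed to \<open>0\<close>, and if \<open>\<alpha>1 = 1\<close> every index survives and the density is
  \<open>s 0\<close>.\<close>

section \<open>Densities uniform in the position of the interval\<close>

lemma eventually_long_intervals:
  "eventually P long_intervals \<longleftrightarrow>
     (\<exists>N. \<forall>a b. 1 \<le> a \<longrightarrow> a < b \<longrightarrow> N \<le> b - a \<longrightarrow> P (a, b))"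
proof
  assume "eventually P long_intervals"
  then obtain Q where Q: "eventually Q at_top"
    and P: "\<And>p. Q (case p of (a, b) \<Rightarrow> \<bar>a - b\<bar>) \<Longrightarrow>
      p \<in> {(a, b). 1 \<le> a \<and> a < b} \<Longrightarrow> P p"
    unfolding long_intervals_def eventually_inf_principal eventually_filtercomap by blast
  from Q obtain N where N: "\<And>l. N \<le> l \<Longrightarrow> Q l"
    unfolding eventually_at_top_linorder by blast
  have "P (a, b)" if "1 \<le> a" "a < b" "N \<le> b - a" for a b
    using P[of "(a, b)"] N[of "b - a"] that by simp
  then show "\<exists>N. \<forall>a b. 1 \<le> a \<longrightarrow> a < b \<longrightarrow> N \<le> b - a \<longrightarrow> P (a, b)" by blast
next
  assume "\<exists>N. \<forall>a b. 1 \<le> a \<longrightarrow> a < b \<longrightarrow> N \<le> b - a \<longrightarrow> P (a, b)"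
  then obtain N where N: "\<And>a b. 1 \<le> a \<Longrightarrow> a < b \<Longrightarrow> N \<le> b - a \<Longrightarrow> P (a, b)" by blast
  show "eventually P long_intervals"
    unfolding long_intervals_def eventually_inf_principal eventually_filtercomap
    by (rule exI[of _ "\<lambda>l. N \<le> l"]) (auto intro!: N simp: eventually_ge_at_top)
qed

lemma has_density_congI:
  assumes "has_density X d" and "\<And>x. x \<ge> 1 \<Longrightarrow> x \<in> X \<longleftrightarrow> x \<in> Y"
  shows "has_density Y d"
proof -
  have "X \<inter> {a..b} = Y \<inter> {a..b}" if "a \<ge> 1" for a b
    using assms(2) that by auto
  then have "\<forall>\<^sub>F p in long_intervals.
      (case p of (a, b) \<Rightarrow> real (card (X \<inter> {a..b})) / real_of_int \<bar>a - b\<bar>) =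
      (case p of (a, b) \<Rightarrow> real (card (Y \<inter> {a..b})) / real_of_int \<bar>a - b\<bar>)"
    unfolding eventually_long_intervals by auto
  then show ?thesis
    using assms(1) unfolding has_density_def by (simp add: tendsto_cong)
qed

text \<open>A discrepancy that is bounded independently of the position of the interval disappears
  after division by the length, which gives the uniformity that the filter demands.\<close>

lemma has_density_bounded_discrepancy:
  assumes "\<And>a b. 1 \<le> a \<Longrightarrow> a < b \<Longrightarrow>
             \<bar>real (card (X \<inter> {a..b})) - d * real_of_int (b - a)\<bar> \<le> C"
  shows "has_density X d"
  unfolding has_density_def
proof (rule tendstoI)
  fix e :: real assume e: "e > 0"
  obtain N :: int where N: "C / e < real_of_int N"
    using ex_less_of_int by blast
  have "dist (real (card (X \<inter> {a..b})) / real_of_int \<bar>a - b\<bar>) d < e"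
    if ab: "1 \<le> a" "a < b" "N \<le> b - a" for a b
  proof -
    let ?l = "real_of_int (b - a)"
    have l: "?l > 0" "real_of_int \<bar>a - b\<bar> = ?l"
      using ab by auto
    have "C / e < ?l" using N ab by linarith
    then have "C < e * ?l" using e by (simp add: field_simps)
    then have "\<bar>real (card (X \<inter> {a..b})) - d * ?l\<bar> < e * ?l"
      using assms[OF ab(1,2)] by linarith
    moreover have "real (card (X \<inter> {a..b})) / ?l - d = (real (card (X \<inter> {a..b})) - d * ?l) / ?l"
      using l(1) by (simp add: field_simps)
    ultimately show ?thesis
      unfolding dist_real_def l(2) using l(1) by (simp add: abs_divide pos_divide_less_eq)
  qed
  then show "\<forall>\<^sub>F p in long_intervals.
      dist (case p of (a, b) \<Rightarrow> real (card (X \<inter> {a..b})) / real_of_int \<bar>a - b\<bar>) d < e"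
    unfolding eventually_long_intervals by auto
qed

lemma cong_iff_ex_multiple:
  fixes x r m :: int
  shows "[x = r] (mod m) \<longleftrightarrow> (\<exists>t. x = r + m * t)"
  using cong_iff_lin[of r x m] by (simp add: cong_sym_eq)

lemma has_density_finite: "finite X \<Longrightarrow> has_density X 0"
  by (rule has_density_bounded_discrepancy[where C = "real (card X)"]) (auto intro: card_mono)

text \<open>The number of \<open>x = r + m t\<close> in \<open>[a, b]\<close> is a difference of two quotients with
  remainder, hence within \<open>2\<close> of \<open>(b - a) / m\<close> wherever the interval lies.\<close>

lemma has_density_residue_class:
  fixes m r :: int
  assumes m: "m > 0"
  shows "has_density {x. [x = r] (mod m)} (1 / real_of_int m)"
proof (rule has_density_bounded_discrepancy[where C = 2])
  fix a b :: int assume ab: "1 \<le> a" "a < b"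
  define p where "p = (a - 1 - r) div m"
  define q where "q = (b - r) div m"
  have p: "m * p \<le> a - 1 - r" "a - 1 - r < m * p + m"
    using m pos_mod_bound[of m "a - 1 - r"] pos_mod_sign[of m "a - 1 - r"]
      mult_div_mod_eq[of m "a - 1 - r"] unfolding p_def by linarith+
  have q: "m * q \<le> b - r" "b - r < m * q + m"
    using m pos_mod_bound[of m "b - r"] pos_mod_sign[of m "b - r"]
      mult_div_mod_eq[of m "b - r"] unfolding q_def by linarith+
  have "p \<le> q" unfolding p_def q_def using ab m by (intro zdiv_mono1) auto
  have lo: "a \<le> r + m * t \<longleftrightarrow> p < t" for t
  proof
    assume "p < t"
    then have "m * (p + 1) \<le> m * t" using m by (intro mult_left_mono) auto
    then show "a \<le> r + m * t" using p by (simp add: algebra_simps)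
  next
    assume "a \<le> r + m * t"
    then have "m * p < m * t" using p by linarith
    then show "p < t" using m by simp
  qed
  have hi: "r + m * t \<le> b \<longleftrightarrow> t \<le> q" for t
  proof
    assume "t \<le> q"
    then have "m * t \<le> m * q" using m by (intro mult_left_mono) auto
    then show "r + m * t \<le> b" using q by linarith
  next
    assume "r + m * t \<le> b"
    then have "m * t < m * (q + 1)" using q by (simp add: algebra_simps)
    then show "t \<le> q" using m by simp
  qed
  have "{x. [x = r] (mod m)} \<inter> {a..b} = (\<lambda>t. r + m * t) ` {p<..q}"
  proof (intro set_eqI iffI)
    fix x assume x: "x \<in> {x. [x = r] (mod m)} \<inter> {a..b}"
    then obtain t where "x = r + m * t"
      by (auto simp: cong_iff_ex_multiple)
    then show "x \<in> (\<lambda>t. r + m * t) ` {p<..q}" using x lo hi by auto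
  qed (use lo hi in \<open>auto simp: cong_iff_ex_multiple\<close>)
  moreover have "inj_on (\<lambda>t. r + m * t) {p<..q}" using m by (auto intro: inj_onI)
  ultimately have card: "real (card ({x. [x = r] (mod m)} \<inter> {a..b})) = real_of_int (q - p)"
    using \<open>p \<le> q\<close> by (simp add: card_image)
  have "\<bar>m * (q - p) - (b - a)\<bar> \<le> 2 * m"
    using p q m by (simp add: algebra_simps abs_le_iff)
  then have "\<bar>real_of_int m * real_of_int (q - p) - real_of_int (b - a)\<bar> \<le> 2 * real_of_int m"
    by (metis of_int_abs of_int_diff of_int_le_iff of_int_mult of_int_numeral)
  moreover have "real_of_int (q - p) - 1 / real_of_int m * real_of_int (b - a) =
      (real_of_int m * real_of_int (q - p) - real_of_int (b - a)) / real_of_int m"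
    using m by (simp add: field_simps)
  ultimately show "\<bar>real (card ({x. [x = r] (mod m)} \<inter> {a..b})) -
      1 / real_of_int m * real_of_int (b - a)\<bar> \<le> 2"
    unfolding card using m by (simp add: abs_divide pos_divide_le_eq)
qed

lemma has_density_UNIV: "has_density UNIV 1"
  using has_density_residue_class[of 1 0] by simp

lemma has_density_Un:
  assumes "has_density X c" "has_density Y d" "X \<inter> Y = {}"
  shows "has_density (X \<union> Y) (c + d)"
proof -
  have "card ((X \<union> Y) \<inter> {a..b}) = card (X \<inter> {a..b}) + card (Y \<inter> {a..b})" for a b
    using assms(3) card_Un_disjoint[of "X \<inter> {a..b}" "Y \<inter> {a..b}"]
    by (auto simp: Int_Un_distrib2)
  then show ?thesis
    using tendsto_add[OF assms(1,2)[unfolded has_density_def case_prod_beta]]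
    unfolding has_density_def case_prod_beta by (simp add: add_divide_distrib)
qed

lemma has_density_diff:
  assumes "has_density X c" "has_density Y d" "Y \<subseteq> X"
  shows "has_density (X - Y) (c - d)"
proof -
  have "real (card ((X - Y) \<inter> {a..b})) = real (card (X \<inter> {a..b})) - real (card (Y \<inter> {a..b}))" for a b
  proof -
    have "(X - Y) \<inter> {a..b} = X \<inter> {a..b} - Y \<inter> {a..b}" by auto
    moreover have "card (Y \<inter> {a..b}) \<le> card (X \<inter> {a..b})"
      using assms(3) by (intro card_mono) auto
    moreover have "Y \<inter> {a..b} \<subseteq> X \<inter> {a..b}" using assms(3) by auto
    ultimately show ?thesis by (simp add: card_Diff_subset)
  qed
  then show ?thesis
    using tendsto_diff[OF assms(1,2)[unfolded has_density_def case_prod_beta]]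
    unfolding has_density_def case_prod_beta by (simp add: diff_divide_distrib)
qed

lemma has_density_eventually_eq:
  assumes "has_density Y d" and eq: "\<And>x. x \<ge> N \<Longrightarrow> x \<in> X \<longleftrightarrow> x \<in> Y"
  shows "has_density X d"
proof -
  have "has_density (Y - Y \<inter> {1..N}) (d - 0)"
    by (rule has_density_diff[OF assms(1) has_density_finite]) auto
  then have "has_density ((Y - Y \<inter> {1..N}) \<union> X \<inter> {1..N}) (d - 0 + 0)"
    by (rule has_density_Un[OF _ has_density_finite]) auto
  then show ?thesis
    using has_density_congI[of "(Y - Y \<inter> {1..N}) \<union> X \<inter> {1..N}" d X] eq by force
qed

text \<open>An infinite intersection is out of reach of the finite set operations above; a vanishing
  sequence of upper bounds settles the case that occurs below.\<close>

lemma has_density_zero_squeeze: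
  assumes cover: "\<And>n. X \<subseteq> Y n" and dens: "\<And>n. has_density (Y n) (d n)"
    and lim: "d \<longlonglongrightarrow> 0"
  shows "has_density X 0"
  unfolding has_density_def
proof (rule tendstoI)
  fix e :: real assume "e > 0"
  then obtain n where n: "d n < e"
    using order_tendstoD(2)[OF lim] eventually_sequentially by force
  have "\<forall>\<^sub>F p in long_intervals.
      (case p of (a, b) \<Rightarrow> real (card (Y n \<inter> {a..b})) / real_of_int \<bar>a - b\<bar>) < e"
    using order_tendstoD(2)[OF dens[of n, unfolded has_density_def] n] .
  then show "\<forall>\<^sub>F p in long_intervals.
      dist (case p of (a, b) \<Rightarrow> real (card (X \<inter> {a..b})) / real_of_int \<bar>a - b\<bar>) 0 < e"
  proof (rule eventually_mono, clarify)
    fix a b :: int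
    assume less: "real (card (Y n \<inter> {a..b})) / real_of_int \<bar>a - b\<bar> < e"
    have "card (X \<inter> {a..b}) \<le> card (Y n \<inter> {a..b})"
      using cover[of n] by (intro card_mono) auto
    then have "real (card (X \<inter> {a..b})) / real_of_int \<bar>a - b\<bar>
        \<le> real (card (Y n \<inter> {a..b})) / real_of_int \<bar>a - b\<bar>"
      by (intro divide_right_mono) auto
    then show "dist (real (card (X \<inter> {a..b})) / real_of_int \<bar>a - b\<bar>) 0 < e"
      using less by simp
  qed
qed

section \<open>Residue classes\<close>

lemma linear_cong_solutions_residue_class:
  fixes a b m :: int
  assumes "coprime a m"
  obtains c where "{k. [a * k = b] (mod m)} = {k. [k = c] (mod m)}"
proof -
  obtain c where c: "[a * c = b] (mod m)"
    using cong_solve_coprime_int[OF assms] cong_scalar_right[of _ 1 m b]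
    by (metis mult.assoc mult_1)
  have "[a * k = b] (mod m) \<longleftrightarrow> [k = c] (mod m)" for k
    using c cong_mult_lcancel[OF assms, of k c] by (meson cong_sym cong_trans)
  then show thesis by (intro that[of c]) auto
qed

lemma residue_class_Int:
  fixes m n :: int
  assumes "coprime m n"
  obtains c where "{k. [k = a] (mod m)} \<inter> {k. [k = b] (mod n)} = {k. [k = c] (mod m * n)}"
proof -
  obtain c where c: "[c = a] (mod m)" "[c = b] (mod n)"
    using binary_chinese_remainder_int[OF assms] by blast
  have "[k = a] (mod m) \<and> [k = b] (mod n) \<longleftrightarrow> [k = c] (mod m * n)" for k
    using c assms coprime_cong_mult[of k c m n] cong_modulus_mult[of k c m n]
      cong_modulus_mult[of k c n m] by (metis cong_sym cong_trans mult.commute)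
  then show thesis by (intro that[of c]) auto
qed

section \<open>Chains of two arithmetic progressions\<close>

lemma floor_int_affine: "\<lfloor>real_of_int a * real k + real_of_int b\<rfloor> = a * int k + b"
  by (metis floor_of_int of_int_add of_int_mult of_int_of_nat_eq)

lemma beatty_set_iff_progression:
  fixes a b x :: int
  assumes "a \<ge> 1" "x \<ge> 1" "x \<ge> a + b"
  shows "x \<in> beatty_set (real_of_int a) (real_of_int b) \<longleftrightarrow> (\<exists>k. x = a * k + b)"
proof
  show "\<exists>k. x = a * k + b" if "x \<in> beatty_set (real_of_int a) (real_of_int b)"
    using that by (auto simp: beatty_set_def beatty_range_def floor_int_affine)
  assume "\<exists>k. x = a * k + b"
  then obtain k where k: "x = a * k + b" by blast
  with assms(3) have "a * 1 \<le> a * k" by simp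
  then have "k \<ge> 1" using assms(1) by (simp add: mult_le_cancel_left)
  then have "nat k \<ge> 1" "x = a * int (nat k) + b" using k by auto
  then show "x \<in> beatty_set (real_of_int a) (real_of_int b)"
    using assms(2) unfolding beatty_set_def beatty_range_def floor_int_affine by blast
qed

locale progression_pair =
  fixes \<alpha> \<beta> \<gamma> \<delta> :: int
  assumes \<alpha>_pos: "1 \<le> \<alpha>" and \<alpha>_less: "\<alpha> < \<gamma>"
begin

abbreviation "S \<equiv> beatty_set (real_of_int \<alpha>) (real_of_int \<beta>)"
abbreviation "T \<equiv> beatty_set (real_of_int \<gamma>) (real_of_int \<delta>)"
abbreviation "f \<equiv> beatty_map (real_of_int \<alpha>) (real_of_int \<beta>) (real_of_int \<gamma>) (real_of_int \<delta>)"
abbreviation "A \<equiv> chain_set (real_of_int \<alpha>) (real_of_int \<beta>) (real_of_int \<gamma>) (real_of_int \<delta>)"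
abbreviation "A_inf \<equiv> chain_set_inf (real_of_int \<alpha>) (real_of_int \<beta>) (real_of_int \<gamma>) (real_of_int \<delta>)"

text \<open>The parametrisation \<open>k \<mapsto> \<alpha> k + \<beta>\<close>, over all integers \<open>k\<close>, turns questions about
  elements of the first progression into questions about their indices.\<close>

definition elt :: "int \<Rightarrow> int" where
  "elt k = \<alpha> * k + \<beta>"

definition shared :: "int set" where
  "shared = {k. \<exists>m. elt k = \<gamma> * m + \<delta>}"

text \<open>The indices whose terms stay in the first progression during \<open>n\<close> applications of
  \<open>\<alpha> k + \<beta> \<mapsto> \<gamma> k + \<delta>\<close>.\<close>

fun survivors :: "nat \<Rightarrow> int set" where
  "survivors 0 = UNIV"
| "survivors (Suc n) = {k. \<exists>k'\<in>survivors n. \<gamma> * k + \<delta> = elt k'}"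

text \<open>Elements of either progression that are at least this large are positive and have an
  index \<open>k \<ge> 1\<close>. Those of the first one satisfy \<open>\<alpha> k + \<beta> \<le> \<gamma> k + \<delta>\<close>: the last entry forces \<open>k \<ge> \<bar>\<delta> - \<beta>\<bar>\<close>, while
  \<open>\<gamma> - \<alpha> \<ge> 1\<close>.\<close>

definition threshold :: int where
  "threshold = Max {1, \<alpha> + \<beta>, \<gamma> + \<delta>, \<alpha> * \<bar>\<delta> - \<beta>\<bar> + \<beta>}"

lemma threshold_ge:
  "1 \<le> threshold" "\<alpha> + \<beta> \<le> threshold" "\<gamma> + \<delta> \<le> threshold" "\<alpha> * \<bar>\<delta> - \<beta>\<bar> + \<beta> \<le> threshold"
  unfolding threshold_def by auto

lemma inj_elt: "inj elt"
  using \<alpha>_pos by (auto simp: elt_def intro: injI)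

lemma S_iff: "x \<ge> threshold \<Longrightarrow> x \<in> S \<longleftrightarrow> x \<in> range elt"
  using beatty_set_iff_progression[of \<alpha> x \<beta>] threshold_ge \<alpha>_pos by (auto simp: elt_def)

lemma T_iff: "x \<ge> threshold \<Longrightarrow> x \<in> T \<longleftrightarrow> (\<exists>m. x = \<gamma> * m + \<delta>)"
  using beatty_set_iff_progression[of \<gamma> x \<delta>] threshold_ge \<alpha>_pos \<alpha>_less by auto

text \<open>The second claim is what makes the threshold usable: orbits that start above it remain
  above it, so that the congruences decide membership for all later iterates, too.\<close>

lemma f_elt:
  assumes "elt k \<ge> threshold"
  shows "f (elt k) = \<gamma> * k + \<delta>" and "\<gamma> * k + \<delta> \<ge> threshold"
proof -
  have "\<alpha> * 1 \<le> \<alpha> * k" "\<alpha> * \<bar>\<delta> - \<beta>\<bar> \<le> \<alpha> * k"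
    using assms threshold_ge by (auto simp: elt_def)
  then have k: "1 \<le> k" "\<bar>\<delta> - \<beta>\<bar> \<le> k"
    using \<alpha>_pos by (auto simp: mult_le_cancel_left)
  show "f (elt k) = \<gamma> * k + \<delta>"
    unfolding beatty_map_def floor_int_affine elt_def
  proof (rule the_equality)
    show "\<exists>n\<ge>1. \<alpha> * k + \<beta> = \<alpha> * int n + \<beta> \<and> \<gamma> * k + \<delta> = \<gamma> * int n + \<delta>"
      using k(1) by (intro exI[of _ "nat k"]) auto
  qed (use \<alpha>_pos in auto)
  have "1 * k \<le> (\<gamma> - \<alpha>) * k"
    using \<alpha>_less k(1) by (intro mult_right_mono) auto
  then show "\<gamma> * k + \<delta> \<ge> threshold"
    using k(2) assms by (simp add: elt_def algebra_simps)
qed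

text \<open>Every survivor lands in the second progression at each step, since \<open>f\<close> takes its values
  there; this is why the recursion for \<open>survivors\<close> mentions the first progression only. The
  induction peels off the first step, because the recursion does.\<close>

lemma survivors_iff_iterates:
  assumes "elt k \<ge> threshold"
  shows "k \<in> survivors n \<longleftrightarrow> (\<forall>j. 1 \<le> j \<and> j \<le> n \<longrightarrow> (f ^^ j) (elt k) \<in> S \<inter> T)"
  using assms
proof (induction n arbitrary: k)
  case 0
  then show ?case by simp
next
  case (Suc n)
  note ft = f_elt[OF Suc.prems]
  have split: "(\<forall>j. 1 \<le> j \<and> j \<le> Suc n \<longrightarrow> (f ^^ j) (elt k) \<in> S \<inter> T) \<longleftrightarrow>
      \<gamma> * k + \<delta> \<in> S \<inter> T \<and> (\<forall>j. 1 \<le> j \<and> j \<le> n \<longrightarrow> (f ^^ j) (\<gamma> * k + \<delta>) \<in> S \<inter> T)"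
    (is "?L \<longleftrightarrow> ?R")
  proof
    assume L: ?L
    show ?R
    proof (intro conjI allI impI)
      show "\<gamma> * k + \<delta> \<in> S \<inter> T" using L[rule_format, of 1] ft by simp
      fix j assume "1 \<le> j \<and> j \<le> n"
      then show "(f ^^ j) (\<gamma> * k + \<delta>) \<in> S \<inter> T"
        using L[rule_format, of "Suc j"] ft by (simp add: funpow_swap1)
    qed
  next
    assume R: ?R
    show ?L
    proof (intro allI impI)
      fix j assume j: "1 \<le> j \<and> j \<le> Suc n"
      then obtain i where i: "j = Suc i" by (cases j) auto
      show "(f ^^ j) (elt k) \<in> S \<inter> T"
        using R j ft unfolding i by (cases "i = 0") (auto simp: funpow_swap1)
    qed
  qed
  have T: "\<gamma> * k + \<delta> \<in> T" using T_iff[OF ft(2)] by blast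
  show ?case
  proof
    assume "k \<in> survivors (Suc n)"
    then obtain k' where k': "k' \<in> survivors n" "\<gamma> * k + \<delta> = elt k'" by auto
    then show "\<forall>j. 1 \<le> j \<and> j \<le> Suc n \<longrightarrow> (f ^^ j) (elt k) \<in> S \<inter> T"
      unfolding split using Suc.IH[of k'] ft(2) T S_iff[OF ft(2)] by auto
  next
    assume *: "\<forall>j. 1 \<le> j \<and> j \<le> Suc n \<longrightarrow> (f ^^ j) (elt k) \<in> S \<inter> T"
    then obtain k' where k': "\<gamma> * k + \<delta> = elt k'"
      unfolding split using S_iff[OF ft(2)] by auto
    then have "k' \<in> survivors n"
      using * ft(2) Suc.IH[of k'] unfolding split by auto
    then show "k \<in> survivors (Suc n)" using k' by auto
  qed
qed

lemma survivors_Suc_subset: "survivors (Suc n) \<subseteq> survivors n"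
  by (induction n) auto

lemma iterates_ge_threshold:
  assumes "elt k \<ge> threshold" "\<forall>j. 1 \<le> j \<and> j \<le> n \<longrightarrow> (f ^^ j) (elt k) \<in> S"
  shows "(f ^^ n) (elt k) \<ge> threshold \<and> (f ^^ n) (elt k) \<in> S"
  using assms
proof (induction n)
  case 0
  then show ?case using S_iff by auto
next
  case (Suc n)
  then have IH: "(f ^^ n) (elt k) \<ge> threshold" "(f ^^ n) (elt k) \<in> S" by auto
  then obtain l where "(f ^^ n) (elt k) = elt l" using S_iff by auto
  then show ?case using Suc.prems(2) IH f_elt[of l] by auto
qed

text \<open>The shift by \<open>2\<close> comes from counting the elements of a chain: the \<open>n\<close> iterates that lie in
  both progressions are preceded by the starting point and followed by the final element. The
  final element lies in the second progression because it is a value of \<open>f\<close>, so only its failure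
  to lie in the first one is a condition.\<close>

lemma chain_set_eventually:
  assumes "x \<ge> threshold"
  shows "x \<in> A (n + 2) \<longleftrightarrow> x \<in> elt ` (survivors n - shared) - elt ` (survivors (Suc n) - shared)"
proof (cases "x \<in> range elt")
  case False
  then show ?thesis using S_iff[OF assms] by (auto simp: chain_set_def)
next
  case True
  then obtain k where k: "x = elt k" by blast
  have tk: "elt k \<ge> threshold" using assms k by simp
  note iter = survivors_iff_iterates[OF tk]
  have xS: "x \<in> S" and xT: "x \<in> T \<longleftrightarrow> k \<in> shared"
    using S_iff[OF assms] T_iff[OF assms] True k by (auto simp: shared_def)
  have A: "x \<in> A (n + 2) \<longleftrightarrow> x \<in> S - T \<and> k \<in> survivors n \<and> (f ^^ (n + 1)) x \<in> T - S"
    unfolding iter k by (cases "n = 0") (auto simp: chain_set_def)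
  have last: "(f ^^ (n + 1)) x \<in> T" if "k \<in> survivors n"
  proof -
    have *: "(f ^^ n) x \<ge> threshold" "(f ^^ n) x \<in> S"
      using iterates_ge_threshold[OF tk] that k unfolding iter by auto
    then obtain l where "(f ^^ n) x = elt l" using S_iff by auto
    then show ?thesis using * f_elt[of l] T_iff[of "\<gamma> * l + \<delta>"] by auto
  qed
  have "k \<in> survivors (Suc n) \<longleftrightarrow> k \<in> survivors n \<and> (f ^^ (n + 1)) x \<in> S \<inter> T"
    unfolding iter k by (auto simp: le_Suc_eq simp del: funpow.simps)
  then have "x \<in> A (n + 2) \<longleftrightarrow> k \<in> survivors n - shared \<and> k \<notin> survivors (Suc n) - shared"
    using A last xS xT by auto
  then show ?thesis
    using inj_image_mem_iff[OF inj_elt, of k] by (simp only: k Diff_iff)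
qed

lemma chain_set_inf_eventually:
  assumes "x \<ge> threshold"
  shows "x \<in> A_inf \<longleftrightarrow> x \<in> elt ` ((\<Inter>n. survivors n) - shared)"
proof (cases "x \<in> range elt")
  case False
  then show ?thesis using S_iff[OF assms] by (auto simp: chain_set_inf_def)
next
  case True
  then obtain k where k: "x = elt k" by blast
  have tk: "elt k \<ge> threshold" using assms k by simp
  have xS: "x \<in> S" and xT: "x \<in> T \<longleftrightarrow> k \<in> shared"
    using S_iff[OF assms] T_iff[OF assms] True k by (auto simp: shared_def)
  have "x \<in> A_inf \<longleftrightarrow> k \<in> (\<Inter>n. survivors n) - shared"
    using xS xT unfolding chain_set_inf_def k INT_iff Diff_iff survivors_iff_iterates[OF tk]
    by auto
  then show ?thesis using inj_image_mem_iff[OF inj_elt, of k] by (simp only: k)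
qed

text \<open>The union of the two progressions is written as a disjoint one, so that densities can be
  added.\<close>

lemma chain_set_1_eventually:
  assumes "x \<ge> threshold"
  shows "x \<in> A 1 \<longleftrightarrow> x \<in> UNIV - ((range elt - elt ` shared) \<union> {x. [x = \<delta>] (mod \<gamma>)})"
proof -
  have "x \<in> T \<longleftrightarrow> [x = \<delta>] (mod \<gamma>)"
    unfolding T_iff[OF assms] by (auto simp: cong_iff_ex_multiple add.commute)
  moreover have "x \<in> elt ` shared \<longleftrightarrow> x \<in> range elt \<and> x \<in> T"
    unfolding T_iff[OF assms] by (auto simp: shared_def)
  ultimately show ?thesis
    using S_iff[OF assms] assms threshold_ge(1) by (auto simp: chain_set_def)
qed

lemma has_density_elt_residue_class:
  assumes "m > 0"
  shows "has_density (elt ` {k. [k = c] (mod m)}) (1 / (real_of_int \<alpha> * real_of_int m))"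
proof -
  have "elt ` {k. [k = c] (mod m)} = {x. [x = elt c] (mod \<alpha> * m)}"
  proof (intro set_eqI iffI)
    fix x assume "x \<in> {x. [x = elt c] (mod \<alpha> * m)}"
    then obtain t where "x = elt (c + m * t)"
      by (auto simp: cong_iff_ex_multiple elt_def algebra_simps)
    then show "x \<in> elt ` {k. [k = c] (mod m)}"
      by (auto simp: cong_iff_ex_multiple)
  qed (auto simp: cong_iff_ex_multiple elt_def algebra_simps)
  moreover have "\<alpha> * m > 0" using \<alpha>_pos assms by simp
  ultimately show ?thesis using has_density_residue_class[of "\<alpha> * m" "elt c"] by simp
qed

lemma has_density_range_elt: "has_density (range elt) (1 / real_of_int \<alpha>)"
  using has_density_elt_residue_class[of 1 0] by simp

lemma has_density_chain_set_1:
  assumes "has_density (elt ` shared) s"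
  shows "has_density (A 1) (1 - 1 / real_of_int \<alpha> - 1 / real_of_int \<gamma> + s)"
proof -
  have dT: "has_density {x. [x = \<delta>] (mod \<gamma>)} (1 / real_of_int \<gamma>)"
    using \<alpha>_pos \<alpha>_less by (intro has_density_residue_class) simp
  have "has_density (range elt - elt ` shared) (1 / real_of_int \<alpha> - s)"
    by (rule has_density_diff[OF has_density_range_elt assms]) auto
  moreover have "(range elt - elt ` shared) \<inter> {x. [x = \<delta>] (mod \<gamma>)} = {}"
    by (auto simp: shared_def cong_iff_ex_multiple add.commute)
  ultimately have "has_density ((range elt - elt ` shared) \<union> {x. [x = \<delta>] (mod \<gamma>)})
      (1 / real_of_int \<alpha> - s + 1 / real_of_int \<gamma>)"
    using has_density_Un[OF _ dT] by blast
  from has_density_diff[OF has_density_UNIV this]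
  have "has_density (A 1) (1 - (1 / real_of_int \<alpha> - s + 1 / real_of_int \<gamma>))"
    using has_density_eventually_eq[OF _ chain_set_1_eventually] by blast
  then show ?thesis by (simp add: algebra_simps)
qed

lemma has_density_chain_set:
  assumes "\<And>n. has_density (elt ` (survivors n - shared)) (s n)"
  shows "has_density (A (n + 2)) (s n - s (Suc n))"
proof -
  have "has_density (elt ` (survivors n - shared) - elt ` (survivors (Suc n) - shared)) (s n - s (Suc n))"
    using survivors_Suc_subset[of n] by (intro has_density_diff assms) blast
  then show ?thesis
    using has_density_eventually_eq[OF _ chain_set_eventually] by blast
qed

lemma has_density_chain_set_inf:
  assumes "has_density (elt ` ((\<Inter>n. survivors n) - shared)) s"
  shows "has_density A_inf s"
  using has_density_eventually_eq[OF assms chain_set_inf_eventually] .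

section \<open>Incompatible progressions\<close>

lemma not_dvd_elt_neq:
  assumes "\<not> gcd \<alpha> \<gamma> dvd \<delta> - \<beta>"
  shows "elt k \<noteq> \<gamma> * m + \<delta>"
proof
  assume "elt k = \<gamma> * m + \<delta>"
  then have "\<delta> - \<beta> = \<alpha> * k - \<gamma> * m" by (simp add: elt_def)
  moreover have "gcd \<alpha> \<gamma> dvd \<alpha> * k - \<gamma> * m" by (intro dvd_diff dvd_mult2) auto
  ultimately show False using assms by simp
qed

lemma densities_not_dvd:
  assumes "\<not> gcd \<alpha> \<gamma> dvd \<delta> - \<beta>"
  shows "has_density (A 1) (1 - 1 / real_of_int \<alpha> - 1 / real_of_int \<gamma>)"
    and "has_density (A (n + 2)) (if n = 0 then 1 / real_of_int \<alpha> else 0)"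
    and "has_density A_inf 0"
proof -
  note neq = not_dvd_elt_neq[OF assms]
  have sh: "shared = {}" using neq by (auto simp: shared_def)
  have surv: "survivors (Suc n) = {}" for n using neq by (auto simp: eq_commute)
  show "has_density (A 1) (1 - 1 / real_of_int \<alpha> - 1 / real_of_int \<gamma>)"
    using has_density_chain_set_1[of 0] has_density_finite[of "{}"] by (simp add: sh)
  define s :: "nat \<Rightarrow> real" where "s n = (if n = 0 then 1 / real_of_int \<alpha> else 0)" for n
  have "has_density (elt ` (survivors n - shared)) (s n)" for n
    using surv has_density_range_elt has_density_finite[of "{}"]
    by (cases n) (simp_all add: s_def sh del: survivors.simps(2))
  from has_density_chain_set[of s, OF this, of n]
  show "has_density (A (n + 2)) (if n = 0 then 1 / real_of_int \<alpha> else 0)"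
    by (simp add: s_def)
  have "(\<Inter>n. survivors n) = {}" using surv by blast
  then show "has_density A_inf 0"
    using has_density_chain_set_inf[of 0] has_density_finite[of "{}"] by simp
qed

section \<open>Compatible progressions\<close>

context
  fixes g \<alpha>1 \<gamma>1 e :: int
  assumes g_pos: "g > 0" and \<alpha>_eq: "\<alpha> = \<alpha>1 * g" and \<gamma>_eq: "\<gamma> = \<gamma>1 * g"
    and coprime_parts: "coprime \<alpha>1 \<gamma>1" and shift_eq: "\<delta> - \<beta> = e * g"
begin

lemma parts_pos: "\<alpha>1 > 0" "\<gamma>1 > 0"
  using \<alpha>_pos \<alpha>_less g_pos \<alpha>_eq \<gamma>_eq
  by (smt (verit) zero_less_mult_iff)+

lemma shared_residue_class:
  obtains c where "shared = {k. [k = c] (mod \<gamma>1)}"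
proof -
  obtain c where c: "{k. [\<alpha>1 * k = e] (mod \<gamma>1)} = {k. [k = c] (mod \<gamma>1)}"
    using linear_cong_solutions_residue_class[OF coprime_parts] by blast
  have "elt k = \<gamma> * m + \<delta> \<longleftrightarrow> \<alpha>1 * k = e + \<gamma>1 * m" for k m
  proof -
    have "elt k - (\<gamma> * m + \<delta>) = g * (\<alpha>1 * k - (e + \<gamma>1 * m))"
      unfolding elt_def using shift_eq by (simp add: \<alpha>_eq \<gamma>_eq algebra_simps)
    then show ?thesis using g_pos by (metis eq_iff_diff_eq_0 less_irrefl mult_eq_0_iff)
  qed
  then have "shared = {k. [\<alpha>1 * k = e] (mod \<gamma>1)}"
    by (auto simp: shared_def cong_iff_ex_multiple)
  then show thesis using c that by simp
qed

text \<open>Divided by \<open>g\<close>, the equation \<open>\<gamma> k + \<delta> = \<alpha> k' + \<beta>\<close> reads \<open>\<gamma>1 k + e = \<alpha>1 k'\<close>. When \<open>k'\<close> runs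
  through a class \<open>c\<close> modulo \<open>\<alpha>1 ^ n\<close>, the right-hand side runs through the class of \<open>\<alpha>1 c\<close> modulo
  \<open>\<alpha>1 ^ (n + 1)\<close>, and \<open>\<gamma>1\<close> is invertible for this modulus. Thus each step costs exactly
  one factor \<open>\<alpha>1\<close>.\<close>

lemma survivors_residue_class:
  obtains c where "survivors n = {k. [k = c] (mod \<alpha>1 ^ n)}"
proof -
  have "\<exists>c. survivors n = {k. [k = c] (mod \<alpha>1 ^ n)}"
  proof (induction n)
    case 0
    then show ?case by simp
  next
    case (Suc n)
    then obtain c where c: "survivors n = {k. [k = c] (mod \<alpha>1 ^ n)}" by blast
    have step: "\<gamma> * k + \<delta> = elt k' \<longleftrightarrow> \<gamma>1 * k + e = \<alpha>1 * k'" for k k'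
    proof -
      have "\<gamma> * k + \<delta> - elt k' = g * (\<gamma>1 * k + e - \<alpha>1 * k')"
        unfolding elt_def using shift_eq by (simp add: \<alpha>_eq \<gamma>_eq algebra_simps)
      then show ?thesis using g_pos by (metis eq_iff_diff_eq_0 less_irrefl mult_eq_0_iff)
    qed
    have "k \<in> survivors (Suc n) \<longleftrightarrow> [\<gamma>1 * k = \<alpha>1 * c - e] (mod \<alpha>1 ^ Suc n)" for k
    proof
      assume "k \<in> survivors (Suc n)"
      then obtain t where "\<gamma>1 * k + e = \<alpha>1 * (c + \<alpha>1 ^ n * t)"
        by (auto simp: c step cong_iff_ex_multiple)
      then have "\<gamma>1 * k = (\<alpha>1 * c - e) + \<alpha>1 ^ Suc n * t" by (simp add: algebra_simps)
      then show "[\<gamma>1 * k = \<alpha>1 * c - e] (mod \<alpha>1 ^ Suc n)"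
        unfolding cong_iff_ex_multiple by blast
    next
      assume "[\<gamma>1 * k = \<alpha>1 * c - e] (mod \<alpha>1 ^ Suc n)"
      then obtain t where "\<gamma>1 * k = (\<alpha>1 * c - e) + \<alpha>1 ^ Suc n * t"
        unfolding cong_iff_ex_multiple by blast
      then have "\<gamma>1 * k + e = \<alpha>1 * (c + \<alpha>1 ^ n * t)" by (simp add: algebra_simps)
      moreover have "c + \<alpha>1 ^ n * t \<in> survivors n"
        by (auto simp: c cong_iff_ex_multiple)
      ultimately show "k \<in> survivors (Suc n)" unfolding survivors.simps step by blast
    qed
    then have "survivors (Suc n) = {k. [\<gamma>1 * k = \<alpha>1 * c - e] (mod \<alpha>1 ^ Suc n)}" by blast
    moreover have "coprime \<gamma>1 (\<alpha>1 ^ Suc n)"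
      using coprime_parts by (simp add: coprime_commute del: power_Suc)
    ultimately show ?case
      by (metis linear_cong_solutions_residue_class)
  qed
  then show thesis using that by blast
qed

lemma has_density_shared: "has_density (elt ` shared) (1 / (real_of_int \<alpha> * real_of_int \<gamma>1))"
  using shared_residue_class has_density_elt_residue_class parts_pos(2) by metis

text \<open>This is \<open>1 / (\<alpha> \<alpha>1 ^ n)\<close>, the density of the survivors, times \<open>1 - 1 / \<gamma>1\<close>, the proportion of
  them outside the second progression.\<close>

definition survivor_density :: "nat \<Rightarrow> real" where
  "survivor_density n = (real_of_int \<gamma>1 - 1) / (real_of_int \<gamma>1 * real_of_int \<alpha> * real_of_int \<alpha>1 ^ n)"

text \<open>The conditions defining the survivors and the shared indices have the coprime moduli
  \<open>\<alpha>1 ^ n\<close> and \<open>\<gamma>1\<close>, so they are independent.\<close>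

lemma has_density_survivors: "has_density (elt ` (survivors n - shared)) (survivor_density n)"
proof -
  obtain c where c: "survivors n = {k. [k = c] (mod \<alpha>1 ^ n)}"
    using survivors_residue_class by blast
  obtain b where b: "shared = {k. [k = b] (mod \<gamma>1)}"
    using shared_residue_class by blast
  have "coprime (\<alpha>1 ^ n) \<gamma>1" using coprime_parts by simp
  then obtain a where a: "survivors n \<inter> shared = {k. [k = a] (mod \<alpha>1 ^ n * \<gamma>1)}"
    unfolding b c using residue_class_Int by blast
  have pos: "\<alpha>1 ^ n > 0" "\<alpha>1 ^ n * \<gamma>1 > 0" using parts_pos by auto
  have "has_density (elt ` survivors n - elt ` (survivors n \<inter> shared))
     (1 / (real_of_int \<alpha> * real_of_int (\<alpha>1 ^ n)) - 1 / (real_of_int \<alpha> * real_of_int (\<alpha>1 ^ n * \<gamma>1)))"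
    unfolding a unfolding c
    by (intro has_density_diff has_density_elt_residue_class pos)
      (use a c in auto)
  moreover have "elt ` survivors n - elt ` (survivors n \<inter> shared) = elt ` (survivors n - shared)"
    using image_set_diff[OF inj_elt, of "survivors n" "survivors n \<inter> shared"]
    by (simp add: Diff_Int_distrib Diff_Int)
  moreover have "1 / (real_of_int \<alpha> * real_of_int (\<alpha>1 ^ n)) - 1 / (real_of_int \<alpha> * real_of_int (\<alpha>1 ^ n * \<gamma>1))
      = survivor_density n"
    using parts_pos \<alpha>_pos by (simp add: survivor_density_def field_simps)
  ultimately show ?thesis by simp
qed

lemma density_chain_set_1:
  "has_density (A 1) (1 - 1 / real_of_int \<alpha> - 1 / real_of_int \<gamma>
     + 1 / (real_of_int g * real_of_int \<alpha>1 * real_of_int \<gamma>1))"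
  using has_density_chain_set_1[OF has_density_shared] by (simp add: \<alpha>_eq mult.commute)

lemma density_chain_set:
  "has_density (A (n + 2)) ((real_of_int \<gamma>1 - 1) * (real_of_int \<alpha>1 - 1)
     / (real_of_int \<gamma>1 * real_of_int \<alpha> * real_of_int \<alpha>1 ^ (n + 1)))"
proof -
  have "survivor_density n - survivor_density (Suc n) = (real_of_int \<gamma>1 - 1) * (real_of_int \<alpha>1 - 1)
     / (real_of_int \<gamma>1 * real_of_int \<alpha> * real_of_int \<alpha>1 ^ (n + 1))"
    using parts_pos \<alpha>_pos by (simp add: survivor_density_def field_simps)
  then show ?thesis
    using has_density_chain_set[OF has_density_survivors, of n] by simp
qed

lemma density_chain_set_inf_if_eq_1:
  assumes "\<alpha>1 = 1"
  shows "has_density A_inf ((real_of_int \<gamma>1 - 1) / (real_of_int \<alpha> * real_of_int \<gamma>1))"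
proof -
  have "survivors n = UNIV" for n
    using survivors_residue_class[of n] assms by (auto simp: cong_def)
  then have "(\<Inter>n. survivors n) = survivors 0" by auto
  then show ?thesis
    using has_density_chain_set_inf has_density_survivors[of 0]
    by (simp add: survivor_density_def mult.commute)
qed

lemma density_chain_set_inf_if_gt_1:
  assumes "\<alpha>1 > 1"
  shows "has_density A_inf 0"
proof (rule has_density_chain_set_inf, rule has_density_zero_squeeze)
  show "elt ` ((\<Inter>n. survivors n) - shared) \<subseteq> elt ` (survivors n - shared)" for n by blast
  show "has_density (elt ` (survivors n - shared)) (survivor_density n)" for n
    by (rule has_density_survivors)
  have "(\<lambda>n. (real_of_int \<gamma>1 - 1) / (real_of_int \<gamma>1 * real_of_int \<alpha>)
      * (1 / real_of_int \<alpha>1) ^ n) \<longlonglongrightarrow> 0"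
    using assms by (intro tendsto_mult_right_zero LIMSEQ_power_zero) simp
  then show "survivor_density \<longlonglongrightarrow> 0"
    by (simp add: survivor_density_def[abs_def] power_one_over field_simps)
qed

end

end

theorem corollary1p6:
  fixes \<alpha> \<beta> \<gamma> \<delta> \<alpha>1 \<gamma>1 :: int
  assumes "1 \<le> \<alpha>" and "\<alpha> < \<gamma>"
    and "\<alpha> = \<alpha>1 * gcd \<alpha> \<gamma>" and "\<gamma> = \<gamma>1 * gcd \<alpha> \<gamma>"
  shows
    "let d = (\<lambda>i. interval_density (chain_set \<alpha> \<beta> \<gamma> \<delta> i));
         d_inf = interval_density (chain_set_inf \<alpha> \<beta> \<gamma> \<delta>)
     in
      (\<forall>i\<ge>1. \<exists>l. has_density (chain_set \<alpha> \<beta> \<gamma> \<delta> i) l) \<and>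
      (\<exists>l. has_density (chain_set_inf \<alpha> \<beta> \<gamma> \<delta>) l) \<and>
      (\<alpha> = 1 \<longrightarrow>
         (\<forall>i\<ge>1. d i = 0) \<and> d_inf = 1 - 1 / real_of_int \<gamma>) \<and>
      (\<not> gcd \<alpha> \<gamma> dvd (\<delta> - \<beta>) \<longrightarrow>
         d 1 = 1 - 1 / real_of_int \<alpha> - 1 / real_of_int \<gamma> \<and>
         d 2 = 1 / real_of_int \<alpha> \<and>
         (\<forall>i\<ge>3. d i = 0) \<and> d_inf = 0) \<and>
      (\<alpha> > 1 \<and> gcd \<alpha> \<gamma> dvd (\<delta> - \<beta>) \<and> \<alpha>1 = 1 \<longrightarrow>
         d 1 = 1 - 1 / real_of_int \<alpha> - 1 / real_of_int \<gamma>
                 + 1 / (real_of_int (gcd \<alpha> \<gamma>) * real_of_int \<alpha>1 * real_of_int \<gamma>1) \<and>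
         (\<forall>i\<ge>2. d i = 0) \<and>
         d_inf = (real_of_int \<gamma>1 - 1) / (real_of_int \<alpha> * real_of_int \<gamma>1)) \<and>
      (\<alpha> > 1 \<and> gcd \<alpha> \<gamma> dvd (\<delta> - \<beta>) \<and> \<alpha>1 > 1 \<longrightarrow>
         d 1 = 1 - 1 / real_of_int \<alpha> - 1 / real_of_int \<gamma>
                 + 1 / (real_of_int (gcd \<alpha> \<gamma>) * real_of_int \<alpha>1 * real_of_int \<gamma>1) \<and>
         (\<forall>i\<ge>2. d i = (real_of_int \<gamma>1 - 1) * (real_of_int \<alpha>1 - 1)
                        / (real_of_int \<gamma>1 * real_of_int \<alpha> * real_of_int \<alpha>1 ^ (i - 1))) \<and>
         d_inf = 0)"
proof -
  interpret progression_pair \<alpha> \<beta> \<gamma> \<delta> using assms by unfold_locales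
  define g where "g = gcd \<alpha> \<gamma>"
  have g_pos: "g > 0" using assms(1) by (simp add: g_def)
  have \<alpha>_eq: "\<alpha> = \<alpha>1 * g" and \<gamma>_eq: "\<gamma> = \<gamma>1 * g" using assms by (simp_all add: g_def)
  have "coprime (\<alpha> div g) (\<gamma> div g)"
    unfolding g_def using assms(1) by (intro div_gcd_coprime) auto
  then have cop: "coprime \<alpha>1 \<gamma>1"
    using g_pos \<alpha>_eq \<gamma>_eq by (metis less_irrefl nonzero_mult_div_cancel_right)
  have idx: "i = (i - 2) + 2" if "i \<ge> 2" for i :: nat using that by simp
  show ?thesis
  proof (cases "g dvd \<delta> - \<beta>")
    case False
    note dens = densities_not_dvd[OF False[unfolded g_def]]
    \<comment> \<open>For \<open>\<alpha> = 1\<close> the greatest common divisor is \<open>1\<close> and divides everything.\<close>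
    have "\<alpha> \<noteq> 1" using False g_def by auto
    have d: "has_density (A i) (if i = 2 then 1 / real_of_int \<alpha> else 0)" if "i \<ge> 2" for i
      using dens(2)[of "i - 2"] that idx[OF that] by (cases "i = 2") (auto simp: numeral_2_eq_2)
    have ex: "\<exists>l. has_density (A i) l" if "i \<ge> 1" for i
      using dens(1) d[of i] that by (cases "i = 1") auto
    show ?thesis
      unfolding Let_def
      using ex dens(3) \<open>\<alpha> \<noteq> 1\<close> False[unfolded g_def] interval_density_eq[OF dens(1)]
        interval_density_eq[OF dens(3)] interval_density_eq[OF d] by auto
  next
    case True
    then obtain e where "\<delta> - \<beta> = e * g" by (metis dvdE mult.commute)
    note ctxt = g_pos \<alpha>_eq \<gamma>_eq cop this
    note d1 = density_chain_set_1[OF ctxt]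
    have d: "has_density (A i) ((real_of_int \<gamma>1 - 1) * (real_of_int \<alpha>1 - 1)
        / (real_of_int \<gamma>1 * real_of_int \<alpha> * real_of_int \<alpha>1 ^ (i - 1)))" if "i \<ge> 2" for i
    proof -
      have "i - 2 + 1 = i - 1" using that by simp
      then show ?thesis using density_chain_set[OF ctxt, of "i - 2"] idx[OF that] by metis
    qed
    note parts = parts_pos[OF ctxt]
    note d_inf1 = density_chain_set_inf_if_eq_1[OF ctxt]
    note d_inf2 = density_chain_set_inf_if_gt_1[OF ctxt]
    have ex: "\<exists>l. has_density (A i) l" if "i \<ge> 1" for i
      using d1 d[of i] that by (cases "i = 1") auto
    have ex_inf: "\<exists>l. has_density A_inf l"
      using d_inf1 d_inf2 parts by (cases "\<alpha>1 = 1") auto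
    \<comment> \<open>For \<open>\<alpha> = 1\<close> the general formulas are specialised to \<open>g = 1\<close>, \<open>\<alpha>1 = 1\<close>, \<open>\<gamma>1 = \<gamma>\<close>.\<close>
    have g1: "g = 1" "\<alpha>1 = 1" "\<gamma>1 = \<gamma>" if "\<alpha> = 1"
    proof -
      show g: "g = 1" using that by (simp add: g_def)
      show "\<alpha>1 = 1" "\<gamma>1 = \<gamma>" using \<alpha>_eq \<gamma>_eq that g by simp_all
    qed
    have one: "(\<forall>i\<ge>1. interval_density (A i) = 0) \<and> interval_density A_inf = 1 - 1 / real_of_int \<gamma>"
      if "\<alpha> = 1"
    proof (intro conjI allI impI)
      fix i :: nat assume "i \<ge> 1"
      then show "interval_density (A i) = 0"
        using interval_density_eq[OF d1] interval_density_eq[OF d, of i] g1[OF that] that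
        by (cases "i = 1") auto
    next
      show "interval_density A_inf = 1 - 1 / real_of_int \<gamma>"
        using interval_density_eq[OF d_inf1] g1[OF that] that assms(2)
        by (simp add: field_simps)
    qed
    show ?thesis
      unfolding Let_def
      using ex ex_inf one True[unfolded g_def] interval_density_eq[OF d1]
        interval_density_eq[OF d] interval_density_eq[OF d_inf1] interval_density_eq[OF d_inf2]
      by (auto simp: g_def)
  qed
qed

end
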